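(* There are no improper $\widetilde{J}$-tangent affine hyperspheres; that is, for $n\ge 1$, no Blaschke hypersurface $f\colon M\to\mathbb{R}^{2n+2}$ with $\dim M=2n+1$ whose affine normal (Blaschke) field is $\widetilde{J}$-tangent has shape operator $S=0$.
   Context: $\widetilde{J}$ is the standard para-complex structure on $\mathbb{R}^{2n+2}$: $\widetilde{J}(x_1,\ldots,x_{n+1},y_1,\ldots,y_{n+1})=(y_1,\ldots,y_{n+1},x_1,\ldots,x_{n+1})$. For an immersion $f\colon M^{N}\to\mathbb{R}^{N+1}$ ($M$ connected, orientable) with transversal field $C$, the induced connection $\nabla$, second fundamental form $h$, shape operator $S$ and transversal connection form $\tau$ are defined by $\mathrm{D}_Xf_*Y=f_*(\nabla_XY)+h(X,Y)C$ and $\mathrm{D}_XC=-f_*(SX)+\tau(X)C$, with $\mathrm{D}$ the flat connection. $f$ is nondegenerate if $h$ is nondegenerate. For nondegenerate $f$ the affine normal (Blaschke) field is the transversal field $C$, unique up to sign, such that the metric volume form $\omega_h(X_1,\ldots,X_N)=|\det[h(X_i,X_j)]|^{1/2}$ (for bases positively oriented with respect to $\Theta$) is $\nabla$-parallel and coincides with the induced volume form $\Theta(X_1,\ldots,X_N)=\det[f_*X_1,\ldots,f_*X_N,C]$; $f$ with this $C$ is a Blaschke hypersurface. It is an affine hypersphere if $S=\lambda I$ with $\lambda$ constant; improper if $\lambda=0$, proper if $\lambda\ne0$. A transversal field $C$ is $\widetilde{J}$-tangent if $\widetilde{J}C_x\in f_*(T_xM)$ for all $x\in M$. A $\widetilde{J}$-tangent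 affine hypersphere is an affine hypersphere whose Blaschke field is $\widetilde{J}$-tangent. *)

theory Defs
  imports "HOL-Analysis.Analysis"
begin

section \<open>Smooth maps and smooth manifolds\<close>

text \<open>
  \<open>Ck_on k S F\<close> is meant for open \<open>S\<close>: all iterated directional derivatives of \<open>F\<close> up to
  order \<open>k\<close> exist and are continuous.
\<close>

primrec Ck_on ::
  "nat \<Rightarrow> 'e::real_normed_vector set \<Rightarrow> ('e \<Rightarrow> 'b::real_normed_vector) \<Rightarrow> bool" where
  "Ck_on 0 S F \<longleftrightarrow> continuous_on S F"
| "Ck_on (Suc k) S F \<longleftrightarrow>
     (\<forall>u\<in>S. F differentiable (at u)) \<and> (\<forall>v. Ck_on k S (\<lambda>u. frechet_derivative F (at u) v))"

definition smooth_on ::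
  "'e::real_normed_vector set \<Rightarrow> ('e \<Rightarrow> 'b::real_normed_vector) \<Rightarrow> bool" where
  "smooth_on S F \<longleftrightarrow> (\<forall>k. Ck_on k S F)"

text \<open>
  A chart is a pair of a domain and a coordinate map; the values of the coordinate map outside
  the domain are irrelevant. The dimension of the manifold is \<open>CARD('m)\<close>.
\<close>

type_synonym ('a, 'm) chart = "'a set \<times> ('a \<Rightarrow> real^'m)"

definition chart_inv :: "('a, 'm::finite) chart \<Rightarrow> real^'m \<Rightarrow> 'a" where
  "chart_inv c = inv_into (fst c) (snd c)"

definition is_chart :: "'a topology \<Rightarrow> ('a, 'm::finite) chart \<Rightarrow> bool" where
  "is_chart X c \<longleftrightarrow> openin X (fst c) \<and> open (snd c ` fst c) \<and>
     homeomorphic_map (subtopology X (fst c)) (top_of_set (snd c ` fst c)) (snd c)"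

definition transition :: "('a, 'm::finite) chart \<Rightarrow> ('a, 'm) chart \<Rightarrow> real^'m \<Rightarrow> real^'m" where
  "transition c d = snd d \<circ> chart_inv c"

definition smooth_atlas :: "'a topology \<Rightarrow> ('a, 'm::finite) chart set \<Rightarrow> bool" where
  "smooth_atlas X A \<longleftrightarrow> (\<forall>c\<in>A. is_chart X c) \<and> (\<Union>c\<in>A. fst c) = topspace X \<and>
     (\<forall>c\<in>A. \<forall>d\<in>A. smooth_on (snd c ` (fst c \<inter> fst d)) (transition c d))"

definition smooth_manifold :: "'a topology \<Rightarrow> ('a, 'm::finite) chart set \<Rightarrow> bool" where
  "smooth_manifold X A \<longleftrightarrow> Hausdorff_space X \<and> second_countable X \<and> smooth_atlas X A"

text \<open>Orientability: the smooth structure given by \<open>A\<close> contains an oriented atlas \<open>B\<close>.\<close>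

definition orientable :: "'a topology \<Rightarrow> ('a, 'm::finite) chart set \<Rightarrow> bool" where
  "orientable X A \<longleftrightarrow> (\<exists>B. smooth_atlas X B \<and> smooth_atlas X (A \<union> B) \<and>
     (\<forall>c\<in>B. \<forall>d\<in>B. \<forall>p\<in>fst c \<inter> fst d.
        det (matrix (frechet_derivative (transition c d) (at (snd c p)))) > 0))"

section \<open>Tangent vectors and vector fields\<close>

text \<open>
  A tangent vector at \<open>p\<close> is the family of its coordinate vectors in all charts around \<open>p\<close>,
  related by the Jacobians of the transition maps. The vector space operations are pointwise;
  components for charts not around \<open>p\<close> are normalised to 0.
\<close>

type_synonym ('a, 'm) tangent = "('a, 'm) chart \<Rightarrow> real^'m"

definition tangent_space ::
  "('a, 'm::finite) chart set \<Rightarrow> 'a \<Rightarrow> ('a, 'm) tangent set" where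
  "tangent_space A p = {v.
     (\<forall>c. c \<notin> A \<or> p \<notin> fst c \<longrightarrow> v c = 0) \<and>
     (\<forall>c\<in>A. \<forall>d\<in>A. p \<in> fst c \<longrightarrow> p \<in> fst d \<longrightarrow>
        v d = frechet_derivative (transition c d) (at (snd c p)) (v c))}"

text \<open>
  The differential at \<open>p\<close> of a map \<open>F\<close> into a normed space, applied to a tangent vector.
  It is computed in some chart around \<open>p\<close>; by the chain rule the choice does not matter.
  It serves both as \<open>f\<^sub>*\<close> and as the flat derivative \<open>D\<^sub>v F\<close> of vector- or real-valued \<open>F\<close>;
  \<open>F\<close> only needs to be given near \<open>p\<close>.
\<close>

definition diff_map ::
  "('a, 'm::finite) chart set \<Rightarrow> ('a \<Rightarrow> 'b::real_normed_vector) \<Rightarrow> 'a \<Rightarrow> ('a, 'm) tangent \<Rightarrow> 'b" where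
  "diff_map A F p v = (let c = (SOME c. c \<in> A \<and> p \<in> fst c) in
     frechet_derivative (F \<circ> chart_inv c) (at (snd c p)) (v c))"

definition smooth_map ::
  "('a, 'm::finite) chart set \<Rightarrow> ('a \<Rightarrow> 'b::real_normed_vector) \<Rightarrow> bool" where
  "smooth_map A F \<longleftrightarrow> (\<forall>c\<in>A. smooth_on (snd c ` fst c) (F \<circ> chart_inv c))"

definition vector_field_on ::
  "('a, 'm::finite) chart set \<Rightarrow> 'a set \<Rightarrow> ('a \<Rightarrow> ('a, 'm) tangent) \<Rightarrow> bool" where
  "vector_field_on A W Y \<longleftrightarrow> (\<forall>p\<in>W. Y p \<in> tangent_space A p) \<and>
     (\<forall>c\<in>A. smooth_on (snd c ` (fst c \<inter> W)) (\<lambda>u. Y (chart_inv c u) c))"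

section \<open>Affine hypersurfaces\<close>

text \<open>
  The ambient space of an \<open>N\<close>-dimensional hypersurface, \<open>N = CARD('m)\<close>, is
  \<open>real^('m option)\<close>, of dimension \<open>N + 1\<close>; the index \<open>None\<close> plays the role of \<open>N + 1\<close>.
\<close>

definition immersion ::
  "'a topology \<Rightarrow> ('a, 'm::finite) chart set \<Rightarrow> ('a \<Rightarrow> real^('m option)) \<Rightarrow> bool" where
  "immersion X A f \<longleftrightarrow> smooth_map A f \<and>
     (\<forall>p\<in>topspace X. inj_on (diff_map A f p) (tangent_space A p))"

text \<open>Transversality: the ambient space is the direct sum of \<open>f\<^sub>*(T\<^sub>pM)\<close> and the line of \<open>C p\<close>.\<close>

definition transversal_field ::
  "'a topology \<Rightarrow> ('a, 'm::finite) chart set \<Rightarrow> ('a \<Rightarrow> real^('m option)) \<Rightarrow>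
     ('a \<Rightarrow> real^('m option)) \<Rightarrow> bool" where
  "transversal_field X A f C \<longleftrightarrow> smooth_map A C \<and>
     (\<forall>p\<in>topspace X. C p \<notin> diff_map A f p ` tangent_space A p \<and>
        (\<forall>w. \<exists>v\<in>tangent_space A p. \<exists>a. w = diff_map A f p v + a *\<^sub>R C p))"

text \<open>
  The objects induced by the Gauss formula \<open>D\<^sub>X f\<^sub>*Y = f\<^sub>*(\<nabla>\<^sub>X Y) + h(X,Y) C\<close> and the Weingarten
  formula \<open>D\<^sub>X C = - f\<^sub>*(S X) + \<tau>(X) C\<close>. They are tensorial in \<open>X\<close>, which is
  therefore given by its value \<open>v\<close> at \<open>p\<close>. For the second fundamental form also \<open>Y\<close> enters only
  through its value \<open>w\<close> at \<open>p\<close>: \<open>h(v,w)\<close> is the common coefficient for all smooth local fields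
  extending \<open>w\<close>.
\<close>

definition induced_conn ::
  "('a, 'm::finite) chart set \<Rightarrow> ('a \<Rightarrow> real^('m option)) \<Rightarrow> ('a \<Rightarrow> real^('m option)) \<Rightarrow>
     'a \<Rightarrow> ('a, 'm) tangent \<Rightarrow> ('a \<Rightarrow> ('a, 'm) tangent) \<Rightarrow> ('a, 'm) tangent" where
  "induced_conn A f C p v Y = (THE z. z \<in> tangent_space A p \<and>
     (\<exists>a. diff_map A (\<lambda>q. diff_map A f q (Y q)) p v = diff_map A f p z + a *\<^sub>R C p))"

definition second_ff ::
  "'a topology \<Rightarrow> ('a, 'm::finite) chart set \<Rightarrow> ('a \<Rightarrow> real^('m option)) \<Rightarrow>
     ('a \<Rightarrow> real^('m option)) \<Rightarrow> 'a \<Rightarrow> ('a, 'm) tangent \<Rightarrow> ('a, 'm) tangent \<Rightarrow> real" where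
  "second_ff X A f C p v w = (THE a.
     \<forall>W Y. openin X W \<and> p \<in> W \<and> vector_field_on A W Y \<and> Y p = w \<longrightarrow>
       (\<exists>z\<in>tangent_space A p.
          diff_map A (\<lambda>q. diff_map A f q (Y q)) p v = diff_map A f p z + a *\<^sub>R C p))"

definition shape_op ::
  "('a, 'm::finite) chart set \<Rightarrow> ('a \<Rightarrow> real^('m option)) \<Rightarrow> ('a \<Rightarrow> real^('m option)) \<Rightarrow>
     'a \<Rightarrow> ('a, 'm) tangent \<Rightarrow> ('a, 'm) tangent" where
  "shape_op A f C p v = (THE z. z \<in> tangent_space A p \<and>
     (\<exists>t. diff_map A C p v = - diff_map A f p z + t *\<^sub>R C p))"

text \<open>Nondegeneracy does not depend on the choice of the transversal field \<open>C\<close>.\<close>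

definition nondegenerate ::
  "'a topology \<Rightarrow> ('a, 'm::finite) chart set \<Rightarrow> ('a \<Rightarrow> real^('m option)) \<Rightarrow>
     ('a \<Rightarrow> real^('m option)) \<Rightarrow> bool" where
  "nondegenerate X A f C \<longleftrightarrow> (\<forall>p\<in>topspace X. \<forall>v\<in>tangent_space A p.
     (\<forall>w\<in>tangent_space A p. second_ff X A f C p v w = 0) \<longrightarrow> v = (\<lambda>_. 0))"

text \<open>
  \<open>\<Theta>(X\<^sub>1,\<dots>,X\<^sub>N) = det [f\<^sub>*X\<^sub>1, \<dots>, f\<^sub>*X\<^sub>N, C]\<close>, with these vectors as columns; the frame is
  indexed by \<open>'m\<close> and the column \<open>None\<close> is the last one.
\<close>

definition induced_vol ::
  "('a, 'm::finite) chart set \<Rightarrow> ('a \<Rightarrow> real^('m option)) \<Rightarrow> ('a \<Rightarrow> real^('m option)) \<Rightarrow>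
     'a \<Rightarrow> ('m \<Rightarrow> ('a, 'm) tangent) \<Rightarrow> real" where
  "induced_vol A f C p E = det (\<chi> i j.
     (case j of Some k \<Rightarrow> diff_map A f p (E k) | None \<Rightarrow> C p) $ i)"

text \<open>
  The volume form \<open>\<omega>\<^sub>h\<close>: it is \<open>\<bar>det [h(X\<^sub>i,X\<^sub>j)]\<bar>\<^sup>1\<^sup>/\<^sup>2\<close> on bases positively oriented with respect
  to \<open>\<Theta>\<close>, hence the negative of this on negatively oriented bases and 0 on linearly dependent
  families, i.e. when \<open>\<Theta>\<close> vanishes.
\<close>

definition metric_vol ::
  "'a topology \<Rightarrow> ('a, 'm::finite) chart set \<Rightarrow> ('a \<Rightarrow> real^('m option)) \<Rightarrow>
     ('a \<Rightarrow> real^('m option)) \<Rightarrow> 'a \<Rightarrow> ('m \<Rightarrow> ('a, 'm) tangent) \<Rightarrow> real" where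
  "metric_vol X A f C p E =
     sgn (induced_vol A f C p E) * sqrt \<bar>det (\<chi> i j. second_ff X A f C p (E i) (E j))\<bar>"

text \<open>
  \<open>\<nabla>\<omega> = 0\<close> for a pointwise given \<open>N\<close>-form \<open>\<omega>\<close>: for all local fields \<open>E\<^sub>i\<close> one has
  \<open>v(\<omega>(E\<^sub>1,\<dots>,E\<^sub>N)) = \<Sum>\<^sub>i \<omega>(E\<^sub>1,\<dots>,\<nabla>\<^sub>v E\<^sub>i,\<dots>,E\<^sub>N)\<close>.
\<close>

definition parallel_form ::
  "'a topology \<Rightarrow> ('a, 'm::finite) chart set \<Rightarrow> ('a \<Rightarrow> real^('m option)) \<Rightarrow>
     ('a \<Rightarrow> real^('m option)) \<Rightarrow> ('a \<Rightarrow> ('m \<Rightarrow> ('a, 'm) tangent) \<Rightarrow> real) \<Rightarrow> bool" where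
  "parallel_form X A f C \<omega> \<longleftrightarrow>
     (\<forall>W E. openin X W \<and> (\<forall>i. vector_field_on A W (E i)) \<longrightarrow>
        (\<forall>p\<in>W. \<forall>v\<in>tangent_space A p.
           diff_map A (\<lambda>q. \<omega> q (\<lambda>i. E i q)) p v =
           (\<Sum>i\<in>UNIV. \<omega> p ((\<lambda>j. E j p)(i := induced_conn A f C p v (E i))))))"

definition blaschke_hypersurface ::
  "'a topology \<Rightarrow> ('a, 'm::finite) chart set \<Rightarrow> ('a \<Rightarrow> real^('m option)) \<Rightarrow>
     ('a \<Rightarrow> real^('m option)) \<Rightarrow> bool" where
  "blaschke_hypersurface X A f C \<longleftrightarrow>
     immersion X A f \<and> transversal_field X A f C \<and> nondegenerate X A f C \<and>
     parallel_form X A f C (metric_vol X A f C) \<and>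
     (\<forall>p\<in>topspace X. \<forall>E. (\<forall>i. E i \<in> tangent_space A p) \<longrightarrow>
        metric_vol X A f C p E = induced_vol A f C p E)"

text \<open>Affine hyperspheres \<open>S = r I\<close> with constant \<open>r\<close>; the improper ones are those with \<open>r = 0\<close>.\<close>

definition affine_hypersphere ::
  "'a topology \<Rightarrow> ('a, 'm::finite) chart set \<Rightarrow> ('a \<Rightarrow> real^('m option)) \<Rightarrow>
     ('a \<Rightarrow> real^('m option)) \<Rightarrow> real \<Rightarrow> bool" where
  "affine_hypersphere X A f C r \<longleftrightarrow> blaschke_hypersurface X A f C \<and>
     (\<forall>p\<in>topspace X. \<forall>v\<in>tangent_space A p. shape_op A f C p v = (\<lambda>c. r *\<^sub>R v c))"

abbreviation improper_affine_hypersphere ::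
  "'a topology \<Rightarrow> ('a, 'm::finite) chart set \<Rightarrow> ('a \<Rightarrow> real^('m option)) \<Rightarrow>
     ('a \<Rightarrow> real^('m option)) \<Rightarrow> bool" where
  "improper_affine_hypersphere X A f C \<equiv> affine_hypersphere X A f C 0"

section \<open>The para-complex structure\<close>

text \<open>
  With \<open>n = CARD('n)\<close>, the type \<open>'n odd_dim\<close> has \<open>2n + 1\<close> and \<open>'n odd_dim option\<close> has \<open>2n + 2\<close>
  elements. The coordinates \<open>x\<^sub>1,\<dots>,x\<^sub>n\<^sub>+\<^sub>1,y\<^sub>1,\<dots>,y\<^sub>n\<^sub>+\<^sub>1\<close> are, for \<open>k :: 'n\<close>:
  \<open>x\<^sub>k\<close> at \<open>Some (Inl (Some k))\<close>, \<open>x\<^sub>n\<^sub>+\<^sub>1\<close> at \<open>Some (Inl None)\<close>,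
  \<open>y\<^sub>k\<close> at \<open>Some (Inr k)\<close>, \<open>y\<^sub>n\<^sub>+\<^sub>1\<close> at \<open>None\<close>.
\<close>

type_synonym 'n odd_dim = "'n option + 'n"

lemma card_odd_dim:
  "CARD('n::finite odd_dim) = 2 * CARD('n) + 1"
  "CARD('n::finite odd_dim option) = 2 * CARD('n) + 2"
  by (simp_all add: card_UNIV_option card_UNIV_sum)

fun swap_xy :: "'n odd_dim option \<Rightarrow> 'n odd_dim option" where
  "swap_xy (Some (Inl (Some k))) = Some (Inr k)"
| "swap_xy (Some (Inl None)) = None"
| "swap_xy (Some (Inr k)) = Some (Inl (Some k))"
| "swap_xy None = Some (Inl None)"

definition J_tilde ::
  "real^('n::finite odd_dim option) \<Rightarrow> real^('n odd_dim option)" where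
  "J_tilde z = (\<chi> i. z $ swap_xy i)"

definition J_tangent ::
  "'a topology \<Rightarrow> ('a, 'n::finite odd_dim) chart set \<Rightarrow> ('a \<Rightarrow> real^('n odd_dim option)) \<Rightarrow>
     ('a \<Rightarrow> real^('n odd_dim option)) \<Rightarrow> bool" where
  "J_tangent X A f C \<longleftrightarrow>
     (\<forall>p\<in>topspace X. J_tilde (C p) \<in> diff_map A f p ` tangent_space A p)"

end

theory Submission
  imports Defs
begin

text \<open>
  If \<open>S = 0\<close>, the Weingarten formula reads \<open>D\<^sub>X C = \<tau>(X) C\<close>. Write
  \<open>\<J> C = f\<^sub>*\<xi>\<close>, where \<open>\<J>\<close> is the para-complex structure. Then
  \<open>D\<^sub>X (f\<^sub>*\<xi>) = \<tau>(X) f\<^sub>*\<xi>\<close> is tangent, so \<open>h(X,\<xi>) = 0\<close> for all \<open>X\<close>, while \<open>\<xi> \<noteq> 0\<close> because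
  \<open>\<J>\<close> is invertible. Hence \<open>det [h(E\<^sub>i,E\<^sub>j)] = 0\<close> for a basis \<open>E\<close> containing \<open>\<xi>\<close>, which
  contradicts \<open>\<omega>\<^sub>h = \<Theta> \<noteq> 0\<close>.
\<close>

section \<open>Calculus of smooth maps\<close>

text \<open>For positive \<open>k\<close> the definition of \<open>Ck_on\<close> asks only for
  differentiability of \<open>F\<close> itself; continuity follows from it.\<close>

lemma Ck_on_continuous: "Ck_on k S F \<Longrightarrow> continuous_on S F"
  by (cases k) (auto intro!: differentiable_imp_continuous_on
      simp: differentiable_on_def differentiable_at_withinI)

lemma Ck_on_mono: "Ck_on (Suc k) S F \<Longrightarrow> Ck_on k S F"
proof (induction k arbitrary: F)
  case 0
  then show ?case using Ck_on_continuous[of "Suc 0"] by simp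
next
  case (Suc k)
  from Suc.prems show ?case
    using Suc.IH by (auto simp del: Ck_on.simps simp: Ck_on.simps(2)[of "Suc k"] Ck_on.simps(2)[of k])
qed

lemma has_derivative_transform_on:
  assumes "(F has_derivative F') (at u)" "open S" "u \<in> S" "\<And>x. x \<in> S \<Longrightarrow> F x = G x"
  shows "(G has_derivative F') (at u)"
  using has_derivative_transform_within_open[OF assms(1-3)] assms(4) by blast

text \<open>\<open>frechet_derivative\<close> is a choice among all derivatives \<open>D\<close>.
  Both functions have the same ones at \<open>u\<close>, so the choices agree even if there are
  none.\<close>

lemma frechet_derivative_cong_on:
  assumes "open S" "u \<in> S" "\<And>x. x \<in> S \<Longrightarrow> F x = G x"
  shows "frechet_derivative F (at u) = frechet_derivative G (at u)"
proof -
  have "(F has_derivative D) (at u) \<longleftrightarrow> (G has_derivative D) (at u)" for D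
    using assms has_derivative_transform_on by metis
  then show ?thesis by (simp add: frechet_derivative_def)
qed

lemma Ck_on_cong:
  assumes "open S" "\<And>u. u \<in> S \<Longrightarrow> F u = G u" "Ck_on k S F"
  shows "Ck_on k S G"
  using assms(2,3)
proof (induction k arbitrary: F G)
  case 0
  then show ?case by (simp cong: continuous_on_cong)
next
  case (Suc k)
  show ?case unfolding Ck_on.simps
  proof (intro conjI ballI allI)
    fix u assume "u \<in> S"
    then show "G differentiable at u"
      using Suc.prems has_derivative_transform_on[OF _ \<open>open S\<close>, of F _ u G]
      unfolding differentiable_def by (simp add: differentiable_def) metis
  next
    fix v
    show "Ck_on k S (\<lambda>u. frechet_derivative G (at u) v)"
    proof (rule Suc.IH[of "\<lambda>u. frechet_derivative F (at u) v"])
      fix u assume "u \<in> S"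
      then show "frechet_derivative F (at u) v = frechet_derivative G (at u) v"
        using frechet_derivative_cong_on[OF assms(1), of u F G] Suc.prems(1) by simp
    qed (use Suc.prems(2) in simp)
  qed
qed

text \<open>Lets an explicit formula \<open>F'\<close> from the differentiation rules stand in for
  \<open>frechet_derivative\<close>; the inductions on \<open>k\<close> below rest on this.\<close>

lemma Ck_on_SucI:
  assumes "open S"
    and "\<And>u. u \<in> S \<Longrightarrow> (F has_derivative F' u) (at u)"
    and "\<And>v. Ck_on k S (\<lambda>u. F' u v)"
  shows "Ck_on (Suc k) S F"
proof -
  have "Ck_on k S (\<lambda>u. frechet_derivative F (at u) v)" for v
    by (rule Ck_on_cong[OF assms(1) _ assms(3)]) (simp add: frechet_derivative_at[OF assms(2)])
  then show ?thesis
    using assms(2) by (auto simp: differentiable_def)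
qed

lemma Ck_on_Suc_has_derivative:
  assumes "Ck_on (Suc k) S F" "u \<in> S"
  shows "(F has_derivative frechet_derivative F (at u)) (at u)"
  using assms by (simp add: frechet_derivative_works)

section \<open>Sums, products and compositions of \<open>Ck_on\<close> maps\<close>

lemma Ck_on_const: "open S \<Longrightarrow> Ck_on k S (\<lambda>_. c)"
proof (induction k arbitrary: c)
  case (Suc k)
  then show ?case by (intro Ck_on_SucI[where F'="\<lambda>_ _. 0"]) auto
qed simp

lemma Ck_on_add:
  assumes "open S" "Ck_on k S F" "Ck_on k S G"
  shows "Ck_on k S (\<lambda>u. F u + G u)"
  using assms(2,3)
proof (induction k arbitrary: F G)
  case 0
  then show ?case by (auto intro: continuous_intros)
next
  case (Suc k)
  show ?case
    by (rule Ck_on_SucI[OF assms(1)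
          has_derivative_add[OF Suc.prems[THEN Ck_on_Suc_has_derivative]]])
      (use Suc in auto)
qed

lemma Ck_on_sum:
  assumes "open S" "finite I" "\<And>i. i \<in> I \<Longrightarrow> Ck_on k S (F i)"
  shows "Ck_on k S (\<lambda>u. \<Sum>i\<in>I. F i u)"
  using assms(2,3) by (induction I) (simp_all add: assms(1) Ck_on_const Ck_on_add)

lemma Ck_on_bounded_linear:
  assumes "open S" "bounded_linear l" "Ck_on k S F"
  shows "Ck_on k S (\<lambda>u. l (F u))"
  using assms(3)
proof (induction k arbitrary: F)
  case 0
  then show ?case
    by (auto intro: continuous_on_compose2[OF linear_continuous_on[OF assms(2)]])
next
  case (Suc k)
  show ?case
    by (rule Ck_on_SucI[OF assms(1)
          bounded_linear.has_derivative[OF assms(2) Suc.prems[THEN Ck_on_Suc_has_derivative]]])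
      (use Suc in auto)
qed

lemma Ck_on_scaleR:
  assumes "open S" "Ck_on k S r" "Ck_on k S F"
  shows "Ck_on k S (\<lambda>u. r u *\<^sub>R F u)"
  using assms(2,3)
proof (induction k arbitrary: r F)
  case 0
  then show ?case by (auto intro: continuous_intros)
next
  case (Suc k)
  \<comment> \<open>The product rule contains \<open>r\<close> and \<open>F\<close>
    undifferentiated, so they are also needed at order \<open>k\<close>.\<close>
  note mono = Suc.prems[THEN Ck_on_mono]
  show ?case
    by (rule Ck_on_SucI[OF assms(1)
          has_derivative_scaleR[OF Suc.prems[THEN Ck_on_Suc_has_derivative]]])
      (use Suc mono in \<open>auto intro!: Ck_on_add assms(1) simp del: Ck_on.simps simp: Ck_on.simps(2)\<close>)
qed

lemma linear_sum_Basis: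
  fixes L :: "'e::euclidean_space \<Rightarrow> 'b::real_vector"
  assumes "linear L"
  shows "L x = (\<Sum>b\<in>Basis. (x \<bullet> b) *\<^sub>R L b)"
proof -
  have "L x = L (\<Sum>b\<in>Basis. (x \<bullet> b) *\<^sub>R b)" by (simp only: euclidean_representation)
  also have "\<dots> = (\<Sum>b\<in>Basis. (x \<bullet> b) *\<^sub>R L b)"
    by (simp only: linear_sum[OF assms] linear_cmul[OF assms])
  finally show ?thesis .
qed

text \<open>The chain rule evaluates the derivative of \<open>F\<close> in a direction that varies
  with \<open>u\<close>, while \<open>Ck_on\<close> speaks of fixed directions only. Expanding that
  direction in \<open>Basis\<close> gives a finite sum of products, to which the induction
  hypothesis applies.\<close>

lemma Ck_on_compose:
  fixes \<phi> :: "'d::real_normed_vector \<Rightarrow> 'e::euclidean_space"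
    and F :: "'e \<Rightarrow> 'b::real_normed_vector"
  assumes "open S" "open T" "\<phi> ` S \<subseteq> T" "Ck_on k S \<phi>" "Ck_on k T F"
  shows "Ck_on k S (\<lambda>u. F (\<phi> u))"
  using assms(4,5)
proof (induction k arbitrary: F)
  case 0
  then show ?case using assms(3) by (auto intro: continuous_on_compose2)
next
  case (Suc k)
  note d\<phi> = Ck_on_Suc_has_derivative[OF Suc.prems(1)]
  have dF: "(F has_derivative frechet_derivative F (at (\<phi> u))) (at (\<phi> u))" if "u \<in> S" for u
    using Ck_on_Suc_has_derivative[OF Suc.prems(2)] assms(3) that by blast
  show ?case
  proof (rule Ck_on_SucI[OF assms(1)])
    fix u assume "u \<in> S"
    show "((\<lambda>u. F (\<phi> u)) has_derivative (\<lambda>v. \<Sum>b\<in>Basis.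
        (frechet_derivative \<phi> (at u) v \<bullet> b) *\<^sub>R frechet_derivative F (at (\<phi> u)) b)) (at u)"
      using has_derivative_compose[OF d\<phi>[OF \<open>u \<in> S\<close>] dF[OF \<open>u \<in> S\<close>]]
      by (subst linear_sum_Basis[OF has_derivative_linear[OF dF[OF \<open>u \<in> S\<close>]], symmetric])
  next
    fix v
    show "Ck_on k S (\<lambda>u. \<Sum>b\<in>Basis.
        (frechet_derivative \<phi> (at u) v \<bullet> b) *\<^sub>R frechet_derivative F (at (\<phi> u)) b)"
    proof (intro Ck_on_sum Ck_on_scaleR assms(1) finite_Basis)
      fix b :: 'e
      show "Ck_on k S (\<lambda>u. frechet_derivative \<phi> (at u) v \<bullet> b)"
        using Suc.prems(1) by (intro Ck_on_bounded_linear[OF assms(1) bounded_linear_inner_left]) simp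
      show "Ck_on k S (\<lambda>u. frechet_derivative F (at (\<phi> u)) b)"
        using Suc.prems by (intro Suc.IH Ck_on_mono[OF Suc.prems(1)]) simp
    qed
  qed
qed

section \<open>Transfer to smooth maps\<close>

lemma smooth_on_has_derivative:
  "smooth_on S F \<Longrightarrow> u \<in> S \<Longrightarrow> (F has_derivative frechet_derivative F (at u)) (at u)"
  unfolding smooth_on_def using Ck_on_Suc_has_derivative by blast

lemma smooth_on_frechet_derivative:
  assumes "smooth_on S F"
  shows "smooth_on S (\<lambda>u. frechet_derivative F (at u) v)"
  unfolding smooth_on_def
proof
  fix k
  have "Ck_on (Suc k) S F" using assms by (auto simp: smooth_on_def simp del: Ck_on.simps)
  then show "Ck_on k S (\<lambda>u. frechet_derivative F (at u) v)" by simp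
qed

lemma smooth_on_cong:
  "open S \<Longrightarrow> (\<And>u. u \<in> S \<Longrightarrow> F u = G u) \<Longrightarrow> smooth_on S F \<Longrightarrow> smooth_on S G"
  unfolding smooth_on_def using Ck_on_cong by blast

lemma smooth_on_compose:
  fixes \<phi> :: "'d::real_normed_vector \<Rightarrow> 'e::euclidean_space"
  assumes "open S" "open T" "\<phi> ` S \<subseteq> T" "smooth_on S \<phi>" "smooth_on T F"
  shows "smooth_on S (\<lambda>u. F (\<phi> u))"
  using assms Ck_on_compose unfolding smooth_on_def by blast

section \<open>Differentiation in a direction normal to a family of subspaces\<close>

lemma has_derivative_imp_lipschitz_at:
  assumes "(F has_derivative F') (at u)"
  obtains K where "K \<ge> 0" "\<forall>\<^sub>F x in nhds u. norm (F x - F u) \<le> K * norm (x - u)"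
proof -
  obtain B where B: "\<And>x. norm (F' x) \<le> norm x * B" "B \<ge> 0"
    using bounded_linear.nonneg_bounded[OF has_derivative_bounded_linear[OF assms]] by blast
  obtain d where d: "d > 0"
    "\<And>x. norm (x - u) < d \<Longrightarrow> norm (F x - F u - F' (x - u)) \<le> 1 * norm (x - u)"
    using assms unfolding has_derivative_at_alt by (meson zero_less_one)
  \<comment> \<open>\<open>B\<close> bounds the derivative, and the summand 1 bounds the
    remainder.\<close>
  have "norm (F x - F u) \<le> (B + 1) * norm (x - u)" if "norm (x - u) < d" for x
  proof -
    have "norm (F x - F u) \<le> norm (F x - F u - F' (x - u)) + norm (F' (x - u))"
      using norm_triangle_ineq[of "F x - F u - F' (x - u)" "F' (x - u)"] by simp
    with d(2)[OF that] B(1)[of "x - u"] show ?thesis by (simp add: algebra_simps)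
  qed
  then have "\<forall>\<^sub>F x in nhds u. norm (F x - F u) \<le> (B + 1) * norm (x - u)"
    using d(1) unfolding eventually_nhds_metric dist_norm by blast
  then show ?thesis using that[of "B + 1"] B(2) by simp
qed

lemma has_derivative_zero_if_quadratic:
  assumes "G u = 0" "\<forall>\<^sub>F x in nhds u. norm (G x) \<le> M * (norm (x - u))\<^sup>2"
  shows "(G has_derivative (\<lambda>_. 0)) (at u)"
  unfolding has_derivative_at_alt
proof (intro conjI allI impI)
  fix e :: real assume "e > 0"
  obtain d where d: "d > 0" "\<And>x. norm (x - u) < d \<Longrightarrow> norm (G x) \<le> M * (norm (x - u))\<^sup>2"
    using assms(2) unfolding eventually_nhds_metric dist_norm by blast
  \<comment> \<open>\<open>\<bar>M\<bar> + 1\<close> is a positive upper bound of \<open>M\<close>,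
    whatever the sign of \<open>M\<close>.\<close>
  define d' where "d' = min d (e / (\<bar>M\<bar> + 1))"
  have "norm (G x) \<le> e * norm (x - u)" if "norm (x - u) < d'" for x
  proof -
    have "norm (x - u) * (\<bar>M\<bar> + 1) \<le> e"
      using that by (simp add: d'_def field_simps)
    have "norm (G x) \<le> M * (norm (x - u))\<^sup>2" using that d by (simp add: d'_def)
    also have "\<dots> \<le> (\<bar>M\<bar> + 1) * (norm (x - u))\<^sup>2" by (intro mult_right_mono) auto
    also have "\<dots> = (norm (x - u) * (\<bar>M\<bar> + 1)) * norm (x - u)" by (simp add: power2_eq_square)
    also have "\<dots> \<le> e * norm (x - u)"
      using \<open>norm (x - u) * (\<bar>M\<bar> + 1) \<le> e\<close> by (intro mult_right_mono) auto
    finally show ?thesis .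
  qed
  moreover have "d' > 0" using d \<open>e > 0\<close> by (simp add: d'_def)
  ultimately show "\<exists>d>0. \<forall>y. norm (y - u) < d \<longrightarrow> norm (G y - G u - 0) \<le> e * norm (y - u)"
    using assms(1) by auto
qed simp

text \<open>The Lipschitz estimates at \<open>u\<close> for the finitely many basis vectors add up
  to an estimate of the operator norm of \<open>L x - L u\<close>, uniform in
  \<open>w\<close>.\<close>

lemma linear_family_lipschitz_at:
  fixes L :: "'d::real_normed_vector \<Rightarrow> 'e::euclidean_space \<Rightarrow> 'b::real_normed_vector"
  assumes "\<forall>\<^sub>F x in nhds u. linear (L x)"
    and "\<And>b. b \<in> Basis \<Longrightarrow> (\<lambda>x. L x b) differentiable at u"
  obtains K where "K \<ge> 0" "\<forall>\<^sub>F x in nhds u. \<forall>w. norm (L x w - L u w) \<le> K * norm (x - u) * norm w"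
proof -
  have "\<exists>K\<ge>0. \<forall>\<^sub>F x in nhds u. norm (L x b - L u b) \<le> K * norm (x - u)" if b: "b \<in> Basis" for b
  proof -
    obtain D where "((\<lambda>x. L x b) has_derivative D) (at u)"
      using assms(2)[OF b] unfolding differentiable_def by blast
    then show ?thesis by (rule has_derivative_imp_lipschitz_at) blast
  qed
  then obtain K where K: "\<And>b. b \<in> Basis \<Longrightarrow> K b \<ge> 0"
    "\<And>b. b \<in> Basis \<Longrightarrow> \<forall>\<^sub>F x in nhds u. norm (L x b - L u b) \<le> K b * norm (x - u)"
    by metis
  have lin: "linear (L u)" using assms(1) eventually_nhds_x_imp_x by blast
  have "\<forall>\<^sub>F x in nhds u. \<forall>b\<in>Basis. norm (L x b - L u b) \<le> K b * norm (x - u)"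
    using K(2) by (simp add: eventually_ball_finite_distrib)
  with assms(1) have "\<forall>\<^sub>F x in nhds u. \<forall>w.
      norm (L x w - L u w) \<le> (\<Sum>b\<in>Basis. K b) * norm (x - u) * norm w"
  proof eventually_elim
    case (elim x)
    show ?case
    proof
      fix w
      have "L x w - L u w = (\<Sum>b\<in>Basis. (w \<bullet> b) *\<^sub>R (L x b - L u b))"
        by (simp add: linear_sum_Basis[OF lin, of w] linear_sum_Basis[OF elim(1), of w]
            sum_subtractf scaleR_diff_right)
      also have "norm \<dots> \<le> (\<Sum>b\<in>Basis. norm w * (K b * norm (x - u)))"
        using elim(2) by (intro sum_norm_le)
          (auto intro!: mult_mono simp: Basis_le_norm)
      also have "\<dots> = (\<Sum>b\<in>Basis. K b) * norm (x - u) * norm w"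
        by (simp add: sum_distrib_left sum_distrib_right mult_ac)
      finally show "norm (L x w - L u w) \<le> (\<Sum>b\<in>Basis. K b) * norm (x - u) * norm w" .
    qed
  qed
  moreover have "(\<Sum>b\<in>Basis. K b) \<ge> 0" using K(1) by (simp add: sum_nonneg)
  ultimately show ?thesis using that by blast
qed

text \<open>
  Writing \<open>H x = L x (\<xi> x)\<close>, the field \<open>\<xi>\<close> need not be differentiable: \<open>\<xi> - Y\<close> is
  \<open>O(|x - u|)\<close> since \<open>L u\<close> is bounded below, and so is the \<open>\<nu>\<close>-component of \<open>L x\<close>, which
  makes \<open>\<nu> \<bullet> (H - L Y)\<close> quadratically small.
\<close>

lemma normal_derivative_eq:
  fixes L :: "'d::real_normed_vector \<Rightarrow> 'e::euclidean_space \<Rightarrow> 'b::euclidean_space"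
  assumes lin: "\<forall>\<^sub>F x in nhds u. linear (L x)"
    and dL: "\<And>b. b \<in> Basis \<Longrightarrow> (\<lambda>x. L x b) differentiable at u"
    and inj: "inj (L u)"
    and dH: "(H has_derivative H') (at u)"
    and H: "\<forall>\<^sub>F x in nhds u. H x \<in> range (L x)"
    and dY: "((\<lambda>x. L x (Y x)) has_derivative D) (at u)"
    and eq: "L u (Y u) = H u"
    and \<nu>: "\<And>w. \<nu> \<bullet> L u w = 0"
  shows "\<nu> \<bullet> D v = \<nu> \<bullet> H' v"
proof -
  obtain K where K: "K \<ge> 0"
    "\<forall>\<^sub>F x in nhds u. \<forall>w. norm (L x w - L u w) \<le> K * norm (x - u) * norm w"
    using linear_family_lipschitz_at[OF lin dL] by blast
  \<comment> \<open>By \<open>eq\<close> the difference vanishes at \<open>u\<close>, so the bound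
    on its increment bounds its value.\<close>
  obtain K' where K': "K' \<ge> 0"
    "\<forall>\<^sub>F x in nhds u. norm (H x - L x (Y x)) \<le> K' * norm (x - u)"
    using has_derivative_imp_lipschitz_at[OF has_derivative_diff[OF dH dY]] eq by auto
  have linu: "linear (L u)" using lin eventually_nhds_x_imp_x by blast
  obtain m where m: "m > 0" "\<And>w. m * norm w \<le> norm (L u w)"
    using linear_inj_bounded_below_pos[OF linu inj] by blast
  \<comment> \<open>So close to \<open>u\<close> the change of \<open>L\<close> costs at most half
    of the lower bound \<open>m\<close>; this half is absorbed when \<open>norm w\<close> is
    estimated.\<close>
  have near: "\<forall>\<^sub>F x in nhds u. K * norm (x - u) < m / 2"
  proof -
    have "((\<lambda>x. K * norm (x - u)) \<longlongrightarrow> K * norm (u - u)) (nhds u)"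
      by (intro tendsto_intros filterlim_ident)
    then show ?thesis using m(1) by (intro order_tendstoD(2)) auto
  qed
  have "\<forall>\<^sub>F x in nhds u. norm (\<nu> \<bullet> (H x - L x (Y x))) \<le>
      (norm \<nu> * K * (2 * K' / m)) * (norm (x - u))\<^sup>2"
    using lin H K(2) K'(2) near
  proof eventually_elim
    case (elim x)
    obtain \<xi> where \<xi>: "H x = L x \<xi>" using elim(2) by blast
    define w where "w = \<xi> - Y x"
    have w: "H x - L x (Y x) = L x w" by (simp add: \<xi> w_def linear_diff[OF elim(1)])
    have "m * norm w \<le> norm (L u w)" by (rule m)
    also have "\<dots> \<le> norm (L x w) + norm (L x w - L u w)"
      using norm_triangle_ineq4[of "L x w" "L x w - L u w"] by simp
    also have "\<dots> \<le> K' * norm (x - u) + (m / 2) * norm w"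
    proof (intro add_mono)
      show "norm (L x w) \<le> K' * norm (x - u)" using elim(4) w by simp
      have "norm (L x w - L u w) \<le> K * norm (x - u) * norm w" using elim(3) by blast
      also have "\<dots> \<le> (m / 2) * norm w" using elim(5) by (intro mult_right_mono) auto
      finally show "norm (L x w - L u w) \<le> (m / 2) * norm w" .
    qed
    finally have "norm w \<le> 2 * K' / m * norm (x - u)"
      using m(1) by (simp add: field_simps)
    have "norm (\<nu> \<bullet> L x w) = norm (\<nu> \<bullet> (L x w - L u w))"
      by (simp add: inner_diff_right \<nu>)
    also have "\<dots> \<le> norm \<nu> * norm (L x w - L u w)"
      by (simp add: Cauchy_Schwarz_ineq2)
    also have "\<dots> \<le> norm \<nu> * (K * norm (x - u) * norm w)"
      using elim(3) by (intro mult_left_mono) auto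
    also have "\<dots> \<le> norm \<nu> * (K * norm (x - u) * (2 * K' / m * norm (x - u)))"
      using \<open>norm w \<le> _\<close> K(1) by (intro mult_left_mono) auto
    finally show ?case by (simp add: w power2_eq_square mult_ac)
  qed
  then have "((\<lambda>x. \<nu> \<bullet> (H x - L x (Y x))) has_derivative (\<lambda>_. 0)) (at u)"
    by (rule has_derivative_zero_if_quadratic[rotated]) (simp add: eq)
  moreover have "((\<lambda>x. \<nu> \<bullet> (H x - L x (Y x))) has_derivative (\<lambda>v. \<nu> \<bullet> (H' v - D v))) (at u)"
    by (intro has_derivative_inner_right has_derivative_diff dH dY)
  ultimately have "(\<lambda>v. \<nu> \<bullet> (H' v - D v)) = (\<lambda>_. 0)"
    using has_derivative_unique by blast
  then have "\<nu> \<bullet> (H' v - D v) = 0" by metis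
  then show ?thesis by (simp add: inner_diff_right)
qed

section \<open>Determinant of a tangent basis completed by a transversal vector\<close>

lemma det_tangent_transversal_ne_0:
  fixes L :: "real^'m::finite \<Rightarrow> real^('m option)" and b :: "'m \<Rightarrow> real^'m"
  assumes L: "linear L" "inj L" and C: "C \<notin> range L"
    and b: "\<And>x. (\<Sum>i\<in>UNIV. x i *\<^sub>R b i) = 0 \<Longrightarrow> \<forall>i. x i = 0"
  shows "det (\<chi> i j. (case j of Some k \<Rightarrow> L (b k) | None \<Rightarrow> C) $ i) \<noteq> 0"
    (is "det ?M \<noteq> 0")
proof -
  \<comment> \<open>The matrix sends \<open>x\<close> to \<open>x $ None *\<^sub>R C + L w\<close>.
    Transversality of \<open>C\<close> kills the coefficient at \<open>None\<close>; injectivity of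
    \<open>L\<close> and independence of \<open>b\<close> kill the others.\<close>
  have ker: "x = 0" if "?M *v x = 0" for x
  proof -
    define w where "w = (\<Sum>i\<in>UNIV. x $ Some i *\<^sub>R b i)"
    have "?M *v x = x $ None *\<^sub>R C + L w"
      by (simp add: vec_eq_iff matrix_vector_mult_def UNIV_option_conv sum.reindex w_def
          linear_sum[OF L(1)] linear_cmul[OF L(1)] mult.commute)
    with that have eq: "x $ None *\<^sub>R C + L w = 0" by simp
    then have eq': "x $ None *\<^sub>R C = - L w" by (simp only: eq_neg_iff_add_eq_0)
    have none: "x $ None = 0"
    proof (rule ccontr)
      assume "x $ None \<noteq> 0"
      then have "C = (1 / x $ None) *\<^sub>R (x $ None *\<^sub>R C)" by simp
      also have "\<dots> = (1 / x $ None) *\<^sub>R L (- w)"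
        by (simp only: linear_neg[OF L(1)] eq')
      also have "\<dots> = L ((1 / x $ None) *\<^sub>R (- w))" by (simp only: linear_cmul[OF L(1)])
      finally show False using C by blast
    qed
    with eq have "L w = L 0" by (simp add: linear_0[OF L(1)])
    then have "w = 0" using L(2) by (rule injD[rotated])
    then have "x $ Some i = 0" for i using b[of "\<lambda>i. x $ Some i"] by (simp add: w_def)
    with none have "x $ j = 0" for j by (cases j) auto
    then show "x = 0" by (simp add: vec_eq_iff)
  qed
  then have "invertible ?M"
    unfolding invertible_left_inverse matrix_left_invertible_ker by blast
  then show ?thesis by (simp add: invertible_det_nz)
qed

section \<open>Tangent vectors in charts\<close>

locale smooth_atlas_space =
  fixes X :: "'a topology" and A :: "('a, 'm::finite) chart set"
  assumes atlas: "smooth_atlas X A"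
begin

lemma is_chart: "c \<in> A \<Longrightarrow> is_chart X c"
  using atlas by (simp add: smooth_atlas_def)

lemma chart_domain_open: "c \<in> A \<Longrightarrow> openin X (fst c)"
  using is_chart by (simp add: is_chart_def)

lemma chart_around:
  assumes "p \<in> topspace X"
  obtains c where "c \<in> A" "p \<in> fst c"
  using assms atlas unfolding smooth_atlas_def by blast

lemma chart_domain_subset: "c \<in> A \<Longrightarrow> fst c \<subseteq> topspace X"
  using chart_domain_open openin_subset by blast

lemma chart_image_open:
  assumes "c \<in> A" "openin X W"
  shows "open (snd c ` (fst c \<inter> W))"
proof -
  have h: "homeomorphic_map (subtopology X (fst c)) (top_of_set (snd c ` fst c)) (snd c)"
    and o: "open (snd c ` fst c)"
    using is_chart[OF assms(1)] by (auto simp: is_chart_def)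
  have "openin (subtopology X (fst c)) (fst c \<inter> W)"
    using assms(2) by (auto simp: openin_subtopology)
  then have "openin (top_of_set (snd c ` fst c)) (snd c ` (fst c \<inter> W))"
    using homeomorphic_imp_open_map[OF h] by (simp add: open_map_def)
  then show ?thesis using o openin_open_trans by blast
qed

lemma chart_inv_chart:
  assumes "c \<in> A" "p \<in> fst c"
  shows "chart_inv c (snd c p) = p"
proof -
  have "inj_on (snd c) (topspace (subtopology X (fst c)))"
    using is_chart[OF assms(1)] homeomorphic_imp_injective_map unfolding is_chart_def by blast
  then have "inj_on (snd c) (fst c)"
    using chart_domain_subset[OF assms(1)] by (simp add: Int_absorb1)
  then show ?thesis using assms(2) by (simp add: chart_inv_def)
qed

lemma transition_chart: "c \<in> A \<Longrightarrow> p \<in> fst c \<Longrightarrow> transition c d (snd c p) = snd d p"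
  by (simp add: transition_def chart_inv_chart)

lemma smooth_transition:
  "c \<in> A \<Longrightarrow> d \<in> A \<Longrightarrow> smooth_on (snd c ` (fst c \<inter> fst d)) (transition c d)"
  using atlas by (simp add: smooth_atlas_def)

section \<open>Jacobians of the transition maps\<close>

definition jacobian :: "('a, 'm) chart \<Rightarrow> ('a, 'm) chart \<Rightarrow> 'a \<Rightarrow> real^'m \<Rightarrow> real^'m" where
  "jacobian c d p = frechet_derivative (transition c d) (at (snd c p))"

lemma transition_has_derivative:
  assumes "c \<in> A" "d \<in> A" "p \<in> fst c" "p \<in> fst d"
  shows "(transition c d has_derivative jacobian c d p) (at (snd c p))"
  unfolding jacobian_def
  by (rule smooth_on_has_derivative[OF smooth_transition]) (use assms in auto)

text \<open>Cocycle rule: near \<open>snd c p\<close> the composite of \<open>transition c d\<close>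
  and \<open>transition d e\<close> agrees with \<open>transition c e\<close>, so the chain rule
  applies.\<close>

lemma jacobian_compose:
  assumes "c \<in> A" "d \<in> A" "e \<in> A" "p \<in> fst c" "p \<in> fst d" "p \<in> fst e"
  shows "jacobian d e p (jacobian c d p x) = jacobian c e p x"
proof -
  have "((\<lambda>u. transition d e (transition c d u)) has_derivative
      (\<lambda>x. jacobian d e p (jacobian c d p x))) (at (snd c p))"
    by (rule has_derivative_compose[OF transition_has_derivative])
      (use assms transition_has_derivative in \<open>simp_all add: transition_chart\<close>)
  then have "(transition c e has_derivative (\<lambda>x. jacobian d e p (jacobian c d p x))) (at (snd c p))"
    by (rule has_derivative_transform_on[OF _ chart_image_open[OF assms(1) chart_domain_open[OF assms(2)]]])
      (use assms in \<open>auto simp: transition_chart\<close>)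
  from has_derivative_unique[OF this transition_has_derivative[OF assms(1,3,4,6)]]
  show ?thesis by (rule fun_cong)
qed

lemma jacobian_self:
  assumes "c \<in> A" "p \<in> fst c"
  shows "jacobian c c p x = x"
proof -
  have "(transition c c has_derivative (\<lambda>x. x)) (at (snd c p))"
    by (rule has_derivative_transform_on[OF has_derivative_ident
          chart_image_open[OF assms(1) chart_domain_open[OF assms(1)]]])
      (use assms in \<open>auto simp: transition_chart\<close>)
  from has_derivative_unique[OF transition_has_derivative[OF assms(1,1,2,2)] this]
  show ?thesis by (rule fun_cong)
qed

text \<open>Inverse of reading off the component at \<open>c\<close>. The other components are
  forced by the transformation rule in \<open>tangent_space\<close>, the zeros by its
  normalisation.\<close>

definition tangent_of :: "('a, 'm) chart \<Rightarrow> 'a \<Rightarrow> real^'m \<Rightarrow> ('a, 'm) tangent" where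
  "tangent_of c p x = (\<lambda>d. if d \<in> A \<and> p \<in> fst d then jacobian c d p x else 0)"

lemma tangent_space_jacobian:
  assumes "v \<in> tangent_space A p" "c \<in> A" "d \<in> A" "p \<in> fst c" "p \<in> fst d"
  shows "v d = jacobian c d p (v c)"
  using assms unfolding tangent_space_def jacobian_def by blast

text \<open>The compatibility that \<open>tangent_space\<close> demands is the cocycle rule.\<close>

lemma tangent_of_in:
  assumes "c \<in> A" "p \<in> fst c"
  shows "tangent_of c p x \<in> tangent_space A p"
  by (simp add: tangent_space_def tangent_of_def jacobian_compose[OF assms(1) _ _ assms(2)]
      flip: jacobian_def)

lemma tangent_of_apply: "c \<in> A \<Longrightarrow> p \<in> fst c \<Longrightarrow> tangent_of c p x c = x"
  by (simp add: tangent_of_def jacobian_self)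

lemma tangent_of_coordinates:
  assumes "c \<in> A" "p \<in> fst c" "v \<in> tangent_space A p"
  shows "tangent_of c p (v c) = v"
proof
  fix d
  show "tangent_of c p (v c) d = v d"
  proof (cases "d \<in> A \<and> p \<in> fst d")
    case True
    then have "v d = jacobian c d p (v c)"
      using assms tangent_space_jacobian by blast
    with True show ?thesis by (simp add: tangent_of_def)
  next
    case False
    then have "v d = 0" using assms(3) unfolding tangent_space_def by blast
    with False show ?thesis by (simp only: tangent_of_def if_False)
  qed
qed

text \<open>Supplies a smooth local extension of any tangent vector, with constant coefficients in
  \<open>c\<close>. Its component in a chart \<open>d\<close> is a directional derivative of
  \<open>transition c d\<close> composed with \<open>transition d c\<close>, hence smooth.\<close>

lemma vector_field_tangent_of:
  assumes c: "c \<in> A"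
  shows "vector_field_on A (fst c) (\<lambda>q. tangent_of c q x)"
  unfolding vector_field_on_def
proof (intro conjI ballI)
  fix p assume "p \<in> fst c"
  then show "tangent_of c p x \<in> tangent_space A p" by (rule tangent_of_in[OF c])
next
  fix d assume d: "d \<in> A"
  let ?S = "snd d ` (fst d \<inter> fst c)" and ?T = "snd c ` (fst c \<inter> fst d)"
  have S: "open ?S" and T: "open ?T"
    by (rule chart_image_open[OF d chart_domain_open[OF c]]
        chart_image_open[OF c chart_domain_open[OF d]])+
  have "transition d c ` ?S \<subseteq> ?T" using d by (auto simp: transition_chart)
  then have "smooth_on ?S (\<lambda>u. frechet_derivative (transition c d) (at (transition d c u)) x)"
    by (rule smooth_on_compose[OF S T _ smooth_transition[OF d c]
          smooth_on_frechet_derivative[OF smooth_transition[OF c d]]])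
  moreover have "frechet_derivative (transition c d) (at (transition d c u)) x =
      tangent_of c (chart_inv d u) x d" if "u \<in> ?S" for u
    using that d by (auto simp: transition_chart chart_inv_chart tangent_of_def jacobian_def)
  ultimately show "smooth_on ?S (\<lambda>u. tangent_of c (chart_inv d u) x d)"
    by (rule smooth_on_cong[OF S, rotated])
qed

text \<open>\<open>diff_map\<close> computes in a chart \<open>d\<close> picked by
  \<open>SOME\<close>. The chain rule along \<open>transition d c\<close> moves the computation to
  \<open>c\<close>, and the Jacobian takes \<open>v d\<close> to \<open>v c\<close>.\<close>

lemma diff_map_chart:
  assumes F: "smooth_map A F" and c: "c \<in> A" "p \<in> fst c" and v: "v \<in> tangent_space A p"
  shows "diff_map A F p v = frechet_derivative (F \<circ> chart_inv c) (at (snd c p)) (v c)"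
proof -
  define d where "d = (SOME c. c \<in> A \<and> p \<in> fst c)"
  have d: "d \<in> A" "p \<in> fst d"
    using someI[of "\<lambda>c. c \<in> A \<and> p \<in> fst c", OF conjI[OF c]] by (auto simp: d_def)
  have dF: "(F \<circ> chart_inv e has_derivative frechet_derivative (F \<circ> chart_inv e) (at (snd e p)))
      (at (snd e p))" if "e \<in> A" "p \<in> fst e" for e
    by (rule smooth_on_has_derivative[of "snd e ` fst e"]) 
      (use F that in \<open>simp_all add: smooth_map_def\<close>)
  have "((\<lambda>u. (F \<circ> chart_inv c) (transition d c u)) has_derivative
      (\<lambda>x. frechet_derivative (F \<circ> chart_inv c) (at (snd c p)) (jacobian d c p x))) (at (snd d p))"
    using dF[OF c] transition_chart[OF d, of c]
    by (intro has_derivative_compose[OF transition_has_derivative[OF d(1) c(1) d(2) c(2)]])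
      (simp only:)
  then have "(F \<circ> chart_inv d has_derivative
      (\<lambda>x. frechet_derivative (F \<circ> chart_inv c) (at (snd c p)) (jacobian d c p x))) (at (snd d p))"
    by (rule has_derivative_transform_on[OF _ chart_image_open[OF d(1) chart_domain_open[OF c(1)]]])
      (use c d in \<open>auto simp: transition_chart chart_inv_chart\<close>)
  then have "frechet_derivative (F \<circ> chart_inv d) (at (snd d p)) =
      (\<lambda>x. frechet_derivative (F \<circ> chart_inv c) (at (snd c p)) (jacobian d c p x))"
    by (rule frechet_derivative_at[symmetric])
  moreover have "jacobian d c p (v d) = v c"
    by (rule tangent_space_jacobian[OF v d(1) c(1) d(2) c(2), symmetric])
  ultimately show ?thesis unfolding diff_map_def Let_def d_def[symmetric] by (simp only:)
qed

section \<open>Immersions with a transversal field\<close>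

text \<open>Reading off the component at \<open>c\<close> is a bijection from the tangent space onto
  the coordinate space, with inverse \<open>tangent_of c p\<close>; injectivity and image of the
  differential therefore pass to \<open>L\<close>.\<close>

lemma immersion_coordinates:
  assumes imm: "immersion X A f" and c: "c \<in> A" "p \<in> fst c"
  defines "L \<equiv> frechet_derivative (f \<circ> chart_inv c) (at (snd c p))"
  shows "linear L" and "inj L"
    and "\<And>w. w \<in> tangent_space A p \<Longrightarrow> diff_map A f p w = L (w c)"
    and "range L = diff_map A f p ` tangent_space A p"
proof -
  have f: "smooth_map A f" and inj_f: "inj_on (diff_map A f p) (tangent_space A p)"
    using imm c chart_domain_subset[OF c(1)] by (auto simp: immersion_def)
  show diff_f: "diff_map A f p w = L (w c)" if "w \<in> tangent_space A p" for w
    using diff_map_chart[OF f c that] by (simp add: L_def)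
  then have diff_f_of: "diff_map A f p (tangent_of c p x) = L x" for x
    by (simp add: tangent_of_in[OF c] tangent_of_apply[OF c])
  show "linear L"
    unfolding L_def
    by (rule has_derivative_linear[OF smooth_on_has_derivative[of "snd c ` fst c"]])
      (use f c in \<open>auto simp: smooth_map_def\<close>)
  show "inj L"
  proof (rule injI)
    fix x y assume "L x = L y"
    then have "tangent_of c p x = tangent_of c p y"
      using tangent_of_in[OF c] inj_f by (auto intro: inj_onD simp: diff_f_of)
    then show "x = y" using tangent_of_apply[OF c] by metis
  qed
  show "range L = diff_map A f p ` tangent_space A p"
  proof
    show "range L \<subseteq> diff_map A f p ` tangent_space A p"
      using diff_f_of[symmetric] tangent_of_in[OF c] by blast
  qed (use diff_f in auto)
qed

text \<open>\<open>shape_op\<close> is a definite description, so its value says something only once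
  existence and uniqueness are known. Both follow from the direct sum decomposition and the
  injectivity of \<open>L\<close>. With \<open>S v = 0\<close> the Weingarten formula leaves only
  the multiple of \<open>C p\<close>.\<close>

lemma shape_op_eq_0D:
  assumes imm: "immersion X A f" and tr: "transversal_field X A f C"
    and p: "p \<in> topspace X" and shape: "shape_op A f C p v = (\<lambda>_. 0)"
  obtains t where "diff_map A C p v = t *\<^sub>R C p"
proof -
  obtain c where c: "c \<in> A" "p \<in> fst c" using chart_around[OF p] by blast
  define L where "L = frechet_derivative (f \<circ> chart_inv c) (at (snd c p))"
  note linL = immersion_coordinates(1)[OF imm c, folded L_def]
    and injL = immersion_coordinates(2)[OF imm c, folded L_def]
    and diff_f = immersion_coordinates(3)[OF imm c, folded L_def]
    and range = immersion_coordinates(4)[OF imm c, folded L_def]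
  have CL: "C p \<notin> range L"
    and split: "\<And>w. \<exists>z\<in>tangent_space A p. \<exists>a. w = diff_map A f p z + a *\<^sub>R C p"
    using tr p range by (auto simp: transversal_field_def)
  define Q where "Q z \<longleftrightarrow> z \<in> tangent_space A p \<and>
    (\<exists>t. diff_map A C p v = - diff_map A f p z + t *\<^sub>R C p)" for z
  obtain y t where y: "y \<in> tangent_space A p" "diff_map A C p v = diff_map A f p y + t *\<^sub>R C p"
    using split by blast
  \<comment> \<open>The Weingarten formula carries a minus sign, so the tangential part
    \<open>y\<close> yields the shape vector \<open>- y\<close>.\<close>
  have Q: "Q (tangent_of c p (- y c))"
    using y tangent_of_in[OF c]
    by (auto simp: Q_def diff_f tangent_of_apply[OF c] linear_neg[OF linL])
  have "z = tangent_of c p (- y c)" if Qz: "Q z" for z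
  proof -
    obtain s where z: "z \<in> tangent_space A p" and
      "diff_map A C p v = - diff_map A f p z + s *\<^sub>R C p" using Qz by (auto simp: Q_def)
    with y have *: "L (y c) + L (z c) = (s - t) *\<^sub>R C p"
      by (simp add: diff_f algebra_simps)
    have "s = t"
    proof (rule ccontr)
      assume "s \<noteq> t"
      then have "C p = (1 / (s - t)) *\<^sub>R ((s - t) *\<^sub>R C p)" by simp
      also have "\<dots> = L ((1 / (s - t)) *\<^sub>R (y c + z c))"
        by (simp only: linear_cmul[OF linL] linear_add[OF linL] *)
      finally show False using CL by blast
    qed
    with * have "L (y c + z c) = L 0" by (simp add: linear_add[OF linL] linear_0[OF linL])
    then have "y c + z c = 0" using injL by (rule injD[rotated])
    then have "z c = - y c" by (simp add: eq_neg_iff_add_eq_0 add.commute)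
    then show ?thesis using tangent_of_coordinates[OF c z] by metis
  qed
  with Q have "Q (THE z. Q z)" by (rule theI)
  moreover have "(THE z. Q z) = (\<lambda>_. 0)"
    using shape by (simp add: shape_op_def Q_def)
  ultimately have "Q (\<lambda>_. 0)" by simp
  then obtain t where "(\<lambda>_. 0) \<in> tangent_space A p"
    "diff_map A C p v = - diff_map A f p (\<lambda>_. 0) + t *\<^sub>R C p"
    unfolding Q_def by blast
  then show ?thesis using that[of t] by (simp add: diff_f linear_0[OF linL])
qed

text \<open>\<open>G\<close> is tangent to the hypersurface everywhere and represents \<xi> at
  \<open>p\<close>. By \<open>normal_derivative_eq\<close> every smooth extension \<open>Y\<close>
  of \<xi> has a derivative with the same normal component as that of \<open>G\<close>, which is
  zero by \<open>dG\<close>. Smoothness is asked of \<open>G\<close> itself, not of its preimage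
  under the differential of \<open>f\<close>.\<close>

lemma second_ff_eq_0:
  assumes imm: "immersion X A f" and tr: "transversal_field X A f C"
    and G: "smooth_map A G" "\<And>q. q \<in> topspace X \<Longrightarrow> G q \<in> diff_map A f q ` tangent_space A q"
    and p: "p \<in> topspace X" and v: "v \<in> tangent_space A p" and \<xi>: "\<xi> \<in> tangent_space A p"
    and Gp: "G p = diff_map A f p \<xi>"
    and dG: "diff_map A G p v \<in> diff_map A f p ` tangent_space A p"
  shows "second_ff X A f C p v \<xi> = 0"
proof -
  \<comment> \<open>This is the chart that \<open>diff_map\<close> itself picks at \<open>p\<close>.
    The map \<open>q \<mapsto> diff_map A f q (Y q)\<close> is controlled only on \<open>W\<close>,
    so \<open>diff_map_chart\<close> cannot change its chart.\<close>
  define c where "c = (SOME c. c \<in> A \<and> p \<in> fst c)"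
  have "\<exists>c. c \<in> A \<and> p \<in> fst c" using chart_around[OF p] by blast
  then have "c \<in> A \<and> p \<in> fst c" unfolding c_def by (rule someI_ex)
  then have c: "c \<in> A" "p \<in> fst c" by (rule conjunct1, rule conjunct2)
  define u where "u = snd c p"
  define L where "L x = frechet_derivative (f \<circ> chart_inv c) (at x)" for x
  have f: "smooth_map A f" using imm by (simp add: immersion_def)
  have f_smooth: "smooth_on (snd c ` fst c) (f \<circ> chart_inv c)"
    using f c by (simp add: smooth_map_def)
  have diff_at_p: "diff_map A F p w = frechet_derivative (F \<circ> chart_inv c) (at u) (w c)" 
    for F :: "'a \<Rightarrow> real^('m option)" and w
    unfolding diff_map_def Let_def c_def[symmetric] u_def ..
  have diff_f: "diff_map A f q w = L (snd c q) (w c)" if "q \<in> fst c" "w \<in> tangent_space A q" for q w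
    using diff_map_chart[OF f c(1) that] by (simp add: L_def)
  have nhds_u: "\<forall>\<^sub>F x in nhds u. x \<in> snd c ` (fst c \<inter> W)" if "openin X W" "p \<in> W" for W
    using chart_image_open[OF c(1) that(1)] c(2) that(2) unfolding u_def
    by (intro eventually_nhds_in_open) auto
  have nhds_c: "\<forall>\<^sub>F x in nhds u. x \<in> snd c ` fst c"
    using nhds_u[OF chart_domain_open[OF c(1)] c(2)] by simp
  have linL: "linear (L x)" if "x \<in> snd c ` fst c" for x
    using smooth_on_has_derivative[OF f_smooth that] has_derivative_linear unfolding L_def by blast
  have lin: "\<forall>\<^sub>F x in nhds u. linear (L x)"
    using nhds_c linL by (rule eventually_mono)
  have dL: "(\<lambda>x. L x b) differentiable at u" for b
    using smooth_on_has_derivative[OF smooth_on_frechet_derivative[OF f_smooth], of u b] c(2)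
    unfolding L_def u_def differentiable_def by blast
  note linu = immersion_coordinates(1)[OF imm c, folded u_def, folded L_def]
    and inj = immersion_coordinates(2)[OF imm c, folded u_def, folded L_def]
    and range = immersion_coordinates(4)[OF imm c, folded u_def, folded L_def]
  have Cp: "C p \<notin> range (L u)"
    and split: "\<And>w. \<exists>z\<in>tangent_space A p. \<exists>a. w = diff_map A f p z + a *\<^sub>R C p"
    using tr p range by (auto simp: transversal_field_def)
  \<comment> \<open>The tangent hyperplane misses \<open>C p\<close>, hence has a nonzero normal
    \<nu>. Pairing with \<nu> will read off the coefficient of \<open>C p\<close>.\<close>
  have "span (range (L u)) \<noteq> UNIV"
    using Cp linear_subspace_image[OF linu subspace_UNIV] by (auto simp: span_eq_iff[THEN iffD2])
  then obtain \<nu> where \<nu>: "\<nu> \<noteq> 0" "\<And>w. \<nu> \<bullet> L u w = 0"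
    using span_not_UNIV_orthogonal span_base by (metis rangeI)
  have \<nu>C: "\<nu> \<bullet> C p \<noteq> 0"
  proof
    assume *: "\<nu> \<bullet> C p = 0"
    obtain z a where "z \<in> tangent_space A p" "\<nu> = diff_map A f p z + a *\<^sub>R C p"
      using split[of \<nu>] by blast
    then have "\<nu> \<bullet> \<nu> = 0"
      using * \<nu>(2) diff_f[OF c(2)] by (metis inner_add_right inner_scaleR_right mult_zero_right add_0 u_def)
    then show False using \<nu>(1) by simp
  qed
  define H where "H = G \<circ> chart_inv c"
  have dH: "(H has_derivative frechet_derivative H (at u)) (at u)"
    using smooth_on_has_derivative[of "snd c ` fst c" H u] G(1) c
    by (simp add: H_def u_def smooth_map_def)
  have Hrange: "H x \<in> range (L x)" if x: "x \<in> snd c ` fst c" for x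
  proof -
    obtain q where q: "q \<in> fst c" "x = snd c q" using x by blast
    then obtain w where "w \<in> tangent_space A q" "G q = diff_map A f q w"
      using G(2) chart_domain_subset[OF c(1)] by blast
    then show ?thesis using q c by (simp add: H_def chart_inv_chart diff_f)
  qed
  \<comment> \<open>The term \<open>0 *\<^sub>R C p\<close> keeps the form of the body of
    \<open>second_ff\<close>, with coefficient 0.\<close>
  have main: "\<exists>z\<in>tangent_space A p.
      diff_map A (\<lambda>q. diff_map A f q (Y q)) p v = diff_map A f p z + 0 *\<^sub>R C p"
    if W: "openin X W" "p \<in> W" and Y: "vector_field_on A W Y" "Y p = \<xi>" for W Y
  proof -
    define Z where "Z x = Y (chart_inv c x) c" for x
    define \<Phi> where "\<Phi> = (\<lambda>q. diff_map A f q (Y q)) \<circ> chart_inv c"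
    have \<Phi>: "\<Phi> x = L x (Z x)" if x: "x \<in> snd c ` (fst c \<inter> W)" for x
      using x Y(1) c by (auto simp: \<Phi>_def Z_def chart_inv_chart diff_f vector_field_on_def)
    have dZ: "Z differentiable at u"
      using Y(1) c W(2) smooth_on_has_derivative[of "snd c ` (fst c \<inter> W)" Z u]
      unfolding vector_field_on_def Z_def u_def differentiable_def by blast
    \<comment> \<open>Expanding \<open>Z x\<close> in the basis reduces differentiability of
      \<open>L x (Z x)\<close> to that of products.\<close>
    have "(\<lambda>x. \<Sum>b\<in>Basis. (Z x \<bullet> b) *\<^sub>R L x b) differentiable at u"
      by (intro differentiable_sum ballI differentiable_scaleR differentiable_inner dZ dL
          differentiable_const finite_Basis)
    then obtain D where D: "((\<lambda>x. \<Sum>b\<in>Basis. (Z x \<bullet> b) *\<^sub>R L x b) has_derivative D) (at u)"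
      unfolding differentiable_def by blast
    have D': "((\<lambda>x. L x (Z x)) has_derivative D) (at u)"
    proof (rule has_derivative_transform_on[OF D chart_image_open[OF c(1) chart_domain_open[OF c(1)]]])
      fix x assume "x \<in> snd c ` (fst c \<inter> fst c)"
      then show "(\<Sum>b\<in>Basis. (Z x \<bullet> b) *\<^sub>R L x b) = L x (Z x)"
        by (intro linear_sum_Basis[symmetric] linL) simp
    qed (use c in \<open>simp add: u_def\<close>)
    have "(\<Phi> has_derivative D) (at u)"
      by (rule has_derivative_transform_on[OF D' chart_image_open[OF c(1) W(1)]])
        (use c W \<Phi> in \<open>auto simp: u_def\<close>)
    then have "frechet_derivative \<Phi> (at u) = D" by (rule frechet_derivative_at[symmetric])
    then have Dv: "diff_map A (\<lambda>q. diff_map A f q (Y q)) p v = D (v c)"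
      by (simp add: diff_at_p \<Phi>_def)
    have "\<nu> \<bullet> D (v c) = \<nu> \<bullet> frechet_derivative H (at u) (v c)"
    proof (rule normal_derivative_eq[OF lin dL inj dH _ D' _ \<nu>(2)])
      show "\<forall>\<^sub>F x in nhds u. H x \<in> range (L x)"
        using nhds_c Hrange by (rule eventually_mono)
      show "L u (Z u) = H u"
        using Gp diff_f[OF c(2) \<xi>] Y(2) c by (simp add: Z_def H_def u_def chart_inv_chart)
    qed
    also have "\<dots> = 0"
      using dG \<nu>(2) unfolding range[symmetric] diff_at_p H_def[symmetric] by auto
    finally have normal: "\<nu> \<bullet> D (v c) = 0" .
    obtain z a where z: "z \<in> tangent_space A p" "D (v c) = diff_map A f p z + a *\<^sub>R C p"
      using split by blast
    have "\<nu> \<bullet> D (v c) = a * (\<nu> \<bullet> C p)"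
      by (simp add: z(2) diff_f[OF c(2) z(1)] inner_add_right \<nu>(2) flip: u_def)
    then have "a = 0" using normal \<nu>C by simp
    with z Dv show ?thesis by auto
  qed
  show ?thesis unfolding second_ff_def
  proof (rule the_equality)
    show "\<forall>W Y. openin X W \<and> p \<in> W \<and> vector_field_on A W Y \<and> Y p = \<xi> \<longrightarrow>
       (\<exists>z\<in>tangent_space A p.
          diff_map A (\<lambda>q. diff_map A f q (Y q)) p v = diff_map A f p z + 0 *\<^sub>R C p)"
      using main by blast
  next
    fix a
    assume a: "\<forall>W Y. openin X W \<and> p \<in> W \<and> vector_field_on A W Y \<and> Y p = \<xi> \<longrightarrow>
       (\<exists>z\<in>tangent_space A p.
          diff_map A (\<lambda>q. diff_map A f q (Y q)) p v = diff_map A f p z + a *\<^sub>R C p)"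
    \<comment> \<open>Without an extension of \<xi> every \<open>a\<close> would satisfy the
      description vacuously. The field with constant coefficients provides one, and pairing with
      \<nu> then forces \<open>a = 0\<close>.\<close>
    let ?Y = "\<lambda>q. tangent_of c q (\<xi> c)"
    have Y: "openin X (fst c)" "p \<in> fst c" "vector_field_on A (fst c) ?Y" "?Y p = \<xi>"
      using c \<xi> by (simp_all add: chart_domain_open vector_field_tangent_of tangent_of_coordinates)
    obtain z z' where z: "z \<in> tangent_space A p" "z' \<in> tangent_space A p"
      "diff_map A f p z + a *\<^sub>R C p = diff_map A f p z' + 0 *\<^sub>R C p"
      using main[OF Y] a[rule_format, of "fst c" ?Y] Y by force
    have "\<nu> \<bullet> (diff_map A f p z + a *\<^sub>R C p) = a * (\<nu> \<bullet> C p)"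
      by (simp add: diff_f[OF c(2) z(1)] inner_add_right \<nu>(2) flip: u_def)
    moreover have "\<nu> \<bullet> (diff_map A f p z' + 0 *\<^sub>R C p) = 0"
      by (simp add: diff_f[OF c(2) z(2)] \<nu>(2) flip: u_def)
    ultimately show "a = 0" using z(3) \<nu>C by simp
  qed
qed

end

section \<open>Improper hyperspheres\<close>

lemma linear_J_tilde: "linear J_tilde"
  by (rule linearI) (simp_all add: J_tilde_def vec_eq_iff)

lemma swap_xy_swap_xy: "swap_xy (swap_xy i) = i"
  by (cases i rule: swap_xy.cases) auto

lemma J_tilde_J_tilde: "J_tilde (J_tilde z) = z"
  by (simp add: J_tilde_def vec_eq_iff swap_xy_swap_xy)

theorem theorem4p4:
  fixes X :: "'a topology"
    and A :: "('a, 'n::finite odd_dim) chart set"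
    and f C :: "'a \<Rightarrow> real^('n odd_dim option)"
  assumes "smooth_manifold X A"
    and "topspace X \<noteq> {}"
    and "connected_space X"
    and "orientable X A"
  shows "\<not> (improper_affine_hypersphere X A f C \<and> J_tangent X A f C)"
proof
  assume "improper_affine_hypersphere X A f C \<and> J_tangent X A f C"
  then have imm: "immersion X A f" and tr: "transversal_field X A f C"
    and vol: "\<And>p E. p \<in> topspace X \<Longrightarrow> (\<forall>i. E i \<in> tangent_space A p) \<Longrightarrow>
      metric_vol X A f C p E = induced_vol A f C p E"
    and S: "\<And>p v. p \<in> topspace X \<Longrightarrow> v \<in> tangent_space A p \<Longrightarrow> shape_op A f C p v = (\<lambda>c. 0)"
    and J: "\<And>p. p \<in> topspace X \<Longrightarrow> J_tilde (C p) \<in> diff_map A f p ` tangent_space A p"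
    by (auto simp: affine_hypersphere_def blaschke_hypersurface_def J_tangent_def)
  interpret smooth_atlas_space X A
    using assms(1) by unfold_locales (simp add: smooth_manifold_def)
  obtain p where p: "p \<in> topspace X" using assms(2) by blast
  obtain c where c: "c \<in> A" "p \<in> fst c" using chart_around[OF p] by blast
  define L where "L = frechet_derivative (f \<circ> chart_inv c) (at (snd c p))"
  note linL = immersion_coordinates(1)[OF imm c, folded L_def]
    and injL = immersion_coordinates(2)[OF imm c, folded L_def]
    and diff_f = immersion_coordinates(3)[OF imm c, folded L_def]
    and range = immersion_coordinates(4)[OF imm c, folded L_def]
  have C: "smooth_map A C" and CL: "C p \<notin> range L"
    using tr p range by (simp_all add: transversal_field_def)
  obtain \<xi> where \<xi>: "\<xi> \<in> tangent_space A p" "J_tilde (C p) = diff_map A f p \<xi>"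
    using J[OF p] by blast
  \<comment> \<open>\<open>J_tilde\<close> is an involution, and \<open>C p\<close> is nonzero
    because 0 is tangent.\<close>
  have "\<xi> c \<noteq> 0"
  proof
    assume "\<xi> c = 0"
    then have "J_tilde (C p) = 0" using \<xi> by (simp add: diff_f linear_0[OF linL])
    then have "C p = 0" using J_tilde_J_tilde[of "C p"] linear_0[OF linear_J_tilde] by metis
    then show False using CL linear_0[OF linL] by (metis rangeI)
  qed
  then obtain k where k: "\<xi> c $ k \<noteq> 0" by (auto simp: vec_eq_iff)
  \<comment> \<open>Exchange step: since \<xi> has a nonzero coordinate at \<open>k\<close>,
    replacing the \<open>k\<close>-th standard vector by it leaves a basis.\<close>
  define b where "b i = (if i = k then \<xi> c else axis i 1)" for i
  define E where "E i = tangent_of c p (b i)" for i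
  have E: "E i \<in> tangent_space A p" for i using tangent_of_in[OF c] by (simp add: E_def)
  have Ek: "E k = \<xi>" using tangent_of_coordinates[OF c \<xi>(1)] by (simp add: E_def b_def)
  have JC: "smooth_map A (\<lambda>q. J_tilde (C q))"
    unfolding smooth_map_def smooth_on_def comp_def
  proof (intro ballI allI)
    fix d k assume d: "d \<in> A"
    have "open (snd d ` fst d)" using chart_image_open[OF d chart_domain_open[OF d]] by simp
    moreover have "Ck_on k (snd d ` fst d) (\<lambda>u. C (chart_inv d u))"
      using C d by (simp add: smooth_map_def smooth_on_def comp_def)
    ultimately show "Ck_on k (snd d ` fst d) (\<lambda>u. J_tilde (C (chart_inv d u)))"
      using Ck_on_bounded_linear linear_J_tilde[unfolded linear_conv_bounded_linear] by blast
  qed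
  have dC: "(C \<circ> chart_inv c has_derivative frechet_derivative (C \<circ> chart_inv c) (at (snd c p)))
      (at (snd c p))"
    by (rule smooth_on_has_derivative[of "snd c ` fst c"]) (use C c in \<open>auto simp: smooth_map_def\<close>)
  \<comment> \<open>A fixed linear map commutes with the flat derivative.\<close>
  have dJC: "diff_map A (\<lambda>q. J_tilde (C q)) p v = J_tilde (diff_map A C p v)"
    if v: "v \<in> tangent_space A p" for v
  proof -
    have "((\<lambda>q. J_tilde (C q)) \<circ> chart_inv c has_derivative
        (\<lambda>x. J_tilde (frechet_derivative (C \<circ> chart_inv c) (at (snd c p)) x))) (at (snd c p))"
      using bounded_linear.has_derivative[OF linear_J_tilde[unfolded linear_conv_bounded_linear] dC]
      by (simp add: comp_def)
    from frechet_derivative_at[OF this] show ?thesis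
      unfolding diff_map_chart[OF JC c v] diff_map_chart[OF C c v] by metis
  qed
  have h0: "second_ff X A f C p v \<xi> = 0" if v: "v \<in> tangent_space A p" for v
  proof (rule second_ff_eq_0[OF imm tr JC J p v \<xi>])
    \<comment> \<open>\<open>t\<close> is the value of the transversal connection form on
      \<open>v\<close>. The same factor multiplies \<open>J_tilde (C p)\<close>, whose derivative is
      therefore tangent.\<close>
    obtain t where "diff_map A C p v = t *\<^sub>R C p"
      using shape_op_eq_0D[OF imm tr p S[OF p v]] by blast
    then have "diff_map A (\<lambda>q. J_tilde (C q)) p v = t *\<^sub>R J_tilde (C p)"
      by (simp add: dJC[OF v] linear_cmul[OF linear_J_tilde])
    also have "\<dots> = diff_map A f p (tangent_of c p (t *\<^sub>R \<xi> c))"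
      by (simp add: \<xi> diff_f tangent_of_in[OF c] tangent_of_apply[OF c] linear_cmul[OF linL])
    finally show "diff_map A (\<lambda>q. J_tilde (C q)) p v \<in> diff_map A f p ` tangent_space A p"
      using tangent_of_in[OF c] by blast
  qed
  \<comment> \<open>In \<open>h0\<close> the vector \<xi> is the second argument, so the vanishing
    entries fill column \<open>k\<close>.\<close>
  have "det (\<chi> i j. second_ff X A f C p (E i) (E j)) = 0"
    by (rule det_zero_column[of k]) (simp add: column_def vec_eq_iff Ek h0[OF E])
  then have "metric_vol X A f C p E = 0" by (simp add: metric_vol_def)
  then have "induced_vol A f C p E = 0" using vol[OF p, of E] E by simp
  moreover have "induced_vol A f C p E \<noteq> 0"
  proof -
    have indep: "\<forall>i. x i = 0" if x: "(\<Sum>i\<in>UNIV. x i *\<^sub>R b i) = 0" for x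
    proof -
      \<comment> \<open>The \<open>j\<close>-th coordinate of the relation. At \<open>j = k\<close>
        only the term of \<xi> is left, which gives \<open>x k = 0\<close>; the remaining
        coordinates then give \<open>x j = 0\<close>.\<close>
      have comp: "x k * \<xi> c $ j + (if j = k then 0 else x j) = 0" for j
      proof -
        have "0 = (\<Sum>i\<in>UNIV. x i *\<^sub>R b i) $ j" by (simp add: x)
        also have "\<dots> = x k * \<xi> c $ j + (\<Sum>i\<in>UNIV - {k}. x i * axis i 1 $ j)"
          by (simp add: sum_component sum.remove[of UNIV k] b_def)
        also have "(\<Sum>i\<in>UNIV - {k}. x i * axis i 1 $ j) =
            (\<Sum>i\<in>UNIV - {k}. if i = j then x i else 0)"
          by (rule sum.cong) (auto simp: axis_def)
        finally show ?thesis by (cases "j = k") simp_all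
      qed
      from comp[of k] k have "x k = 0" by simp
      then show ?thesis using comp by simp metis
    qed
    have "diff_map A f p (E i) = L (b i)" for i
      using diff_f[OF E] by (simp add: E_def tangent_of_apply[OF c])
    then show ?thesis
      using det_tangent_transversal_ne_0[where b = b, OF linL injL CL indep]
      by (simp add: induced_vol_def cong: option.case_cong)
  qed
  ultimately show False by simp
qed

end
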